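(* Let $\alpha_k\ge0$, $k\in\mathbb{N}_0$, with $\sum_{k=1}^\infty\alpha_k<1$, and let $(X_n)_{n\in\mathbb{Z}}$ be the stationary INAR($\infty$) sequence with immigration parameter $\alpha_0$ and reproduction coefficients $\alpha_k$, $k\in\mathbb{N}$. For $m\in\mathbb{N}$ and $k_1,\dots,k_m\in\mathbb{N}_0$, $$\mathbb{E}\big[X_1^{k_1}X_2^{k_2}\cdots X_m^{k_m}\big]<\infty.$$
   Context: INAR($\infty$): Given $\alpha_k\ge0$ ($k\in\mathbb{N}_0$) with $\sum_{k\ge1}\alpha_k<1$, let $\varepsilon_n$, $n\in\mathbb{Z}$, be i.i.d. $\mathrm{Pois}(\alpha_0)$ and $\xi^{(n,k)}_l\sim\mathrm{Pois}(\alpha_k)$ independently over $n\in\mathbb{Z}$, $k,l\in\mathbb{N}$ and independent of $(\varepsilon_n)$. The INAR($\infty$) sequence with immigration parameter $\alpha_0$ and reproduction coefficients $\alpha_k$, $k\in\mathbb{N}$, is the almost surely unique (strictly) stationary $\mathbb{N}_0$-valued solution $(X_n)_{n\in\mathbb{Z}}$ of $X_n=\varepsilon_n+\sum_{k=1}^\infty\sum_{l=1}^{X_{n-k}}\xi^{(n,k)}_l$, $n\in\mathbb{Z}$, where $\varepsilon_n$ and $(\xi^{(n,k)}_l)_{k,l}$ are independent of $X_{n-1},X_{n-2},\dots$. Its mean is $\alpha_0/(1-\sum_{k\ge1}\alpha_k)$. *)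

theory Defs
  imports "HOL-Probability.Probability"
begin

text \<open>The library's \<^const>\<open>poisson_pmf\<close> is only specified for positive rates;
  the Poisson law with rate \<open>0\<close> is the point mass at \<open>0\<close>.\<close>

definition pois_pmf :: "real \<Rightarrow> nat pmf" where
  "pois_pmf r = (if r = 0 then return_pmf 0 else poisson_pmf r)"

text \<open>All innovations as one family: \<open>Inl n\<close> stands for the immigration variable at time \<open>n\<close>,
  \<open>Inr (n, k, l)\<close> for the offspring variable with time \<open>n\<close>, lag \<open>k\<close> and individual \<open>l\<close>.
  Lags and individuals are numbered from \<open>1\<close>; the values of \<open>xi n k l\<close> for \<open>k = 0\<close> or \<open>l = 0\<close>
  are junk and never used.\<close>

definition innov ::
  "(int \<Rightarrow> 'a \<Rightarrow> nat) \<Rightarrow> (int \<Rightarrow> nat \<Rightarrow> nat \<Rightarrow> 'a \<Rightarrow> nat) \<Rightarrow> int + int \<times> nat \<times> nat \<Rightarrow> 'a \<Rightarrow> nat" where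
  "innov eps xi i = (case i of Inl n \<Rightarrow> eps n | Inr (n, k, l) \<Rightarrow> xi n k l)"

definition innov_index_at :: "int \<Rightarrow> (int + int \<times> nat \<times> nat) set" where
  "innov_index_at n = {n} <+> ({n} \<times> {1..} \<times> {1..})"

definition innov_index :: "(int + int \<times> nat \<times> nat) set" where
  "innov_index = UNIV <+> (UNIV \<times> {1..} \<times> {1..})"

definition inar_innovations ::
  "'a measure \<Rightarrow> (nat \<Rightarrow> real) \<Rightarrow> (int \<Rightarrow> 'a \<Rightarrow> nat) \<Rightarrow> (int \<Rightarrow> nat \<Rightarrow> nat \<Rightarrow> 'a \<Rightarrow> nat) \<Rightarrow> bool" where
  "inar_innovations M \<alpha> eps xi \<longleftrightarrow>
     prob_space.indep_vars M (\<lambda>_. count_space UNIV) (innov eps xi) innov_index \<and>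
     (\<forall>n. distr M (count_space UNIV) (eps n) = measure_pmf (pois_pmf (\<alpha> 0))) \<and>
     (\<forall>n. \<forall>k\<ge>1. \<forall>l\<ge>1.
        distr M (count_space UNIV) (xi n k l) = measure_pmf (pois_pmf (\<alpha> k)))"

text \<open>The series over the lags \<open>k \<ge> 1\<close> is taken in \<^typ>\<open>ennreal\<close>, where it always has its true
  (possibly infinite) value, so the equation forces it to be finite almost surely.\<close>

definition inar_equation ::
  "'a measure \<Rightarrow> (int \<Rightarrow> 'a \<Rightarrow> nat) \<Rightarrow> (int \<Rightarrow> nat \<Rightarrow> nat \<Rightarrow> 'a \<Rightarrow> nat) \<Rightarrow> (int \<Rightarrow> 'a \<Rightarrow> nat) \<Rightarrow> bool" where
  "inar_equation M eps xi X \<longleftrightarrow>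
     (AE \<omega> in M. \<forall>n. (of_nat (X n \<omega>) :: ennreal) = of_nat (eps n \<omega>) +
        (\<Sum>k. of_nat (\<Sum>l = 1..X (n - int (Suc k)) \<omega>. xi n (Suc k) l \<omega>)))"

definition inar_causal ::
  "'a measure \<Rightarrow> (int \<Rightarrow> 'a \<Rightarrow> nat) \<Rightarrow> (int \<Rightarrow> nat \<Rightarrow> nat \<Rightarrow> 'a \<Rightarrow> nat) \<Rightarrow> (int \<Rightarrow> 'a \<Rightarrow> nat) \<Rightarrow> bool" where
  "inar_causal M eps xi X \<longleftrightarrow>
     (\<forall>n. prob_space.indep_set M
        {(\<lambda>\<omega>. \<lambda>i\<in>innov_index_at n. innov eps xi i \<omega>) -` A \<inter> space M | A.
           A \<in> sets (Pi\<^sub>M (innov_index_at n) (\<lambda>_. count_space UNIV))}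
        {(\<lambda>\<omega>. \<lambda>j\<in>{..<n}. X j \<omega>) -` A \<inter> space M | A.
           A \<in> sets (Pi\<^sub>M {..<n} (\<lambda>_. count_space UNIV))})"

definition strictly_stationary :: "'a measure \<Rightarrow> (int \<Rightarrow> 'a \<Rightarrow> nat) \<Rightarrow> bool" where
  "strictly_stationary M X \<longleftrightarrow>
     (\<forall>h. distr M (Pi\<^sub>M UNIV (\<lambda>_. count_space UNIV)) (\<lambda>\<omega> n. X (n + h) \<omega>) =
          distr M (Pi\<^sub>M UNIV (\<lambda>_. count_space UNIV)) (\<lambda>\<omega> n. X n \<omega>))"

definition stationary_inar_solution ::
  "'a measure \<Rightarrow> (int \<Rightarrow> 'a \<Rightarrow> nat) \<Rightarrow> (int \<Rightarrow> nat \<Rightarrow> nat \<Rightarrow> 'a \<Rightarrow> nat) \<Rightarrow> (int \<Rightarrow> 'a \<Rightarrow> nat) \<Rightarrow> bool" where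
  "stationary_inar_solution M eps xi X \<longleftrightarrow>
     (\<forall>n. X n \<in> measurable M (count_space UNIV)) \<and>
     inar_equation M eps xi X \<and> inar_causal M eps xi X \<and> strictly_stationary M X"

text \<open>The INAR(\<open>\<infinity>\<close>) sequence is by definition \<^emph>\<open>the\<close> almost surely unique stationary solution;
  this definite description is rendered as: a stationary solution with which every stationary
  solution for the same innovations agrees almost surely.\<close>

definition inar_sequence ::
  "'a measure \<Rightarrow> (nat \<Rightarrow> real) \<Rightarrow> (int \<Rightarrow> 'a \<Rightarrow> nat) \<Rightarrow> (int \<Rightarrow> nat \<Rightarrow> nat \<Rightarrow> 'a \<Rightarrow> nat) \<Rightarrow>
   (int \<Rightarrow> 'a \<Rightarrow> nat) \<Rightarrow> bool" where
  "inar_sequence M \<alpha> eps xi X \<longleftrightarrow>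
     inar_innovations M \<alpha> eps xi \<and>
     stationary_inar_solution M eps xi X \<and>
     (\<forall>Y. stationary_inar_solution M eps xi Y \<longrightarrow> (AE \<omega> in M. \<forall>n. Y n \<omega> = X n \<omega>))"

end

theory Submission
  imports Defs
begin

text \<open>The stationary solution is the increasing limit of the Picard iterates started at \<open>0\<close>, with
  lags truncated so that all sums are finite. Conditionally on the
  past, each iterate is Poisson with an affine function of the previous iterates as its rate, and
  convexity of \<open>exp\<close> turns this into a contraction for the log-Laplace transform near \<open>0\<close>. Hence some
  exponential moment of the iterates is bounded uniformly, so the limit is finite almost surely and
  inherits the bound. As the limit is a stationary solution, it agrees with \<open>X\<close> by uniqueness, and
  mixed moments are dominated by exponential moments.\<close>

section \<open>Picard iterates\<close>

text \<open>Iterate \<open>Suc j\<close> uses the lags \<open>1..j\<close> only, so every iterate is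
  a finite sum of naturals. Innovations enter as a plain configuration \<open>w\<close>, so the
  recursion can be studied pathwise.\<close>

primrec inar_approx :: "nat \<Rightarrow> int \<Rightarrow> (int + int \<times> nat \<times> nat \<Rightarrow> nat) \<Rightarrow> nat" where
  "inar_approx 0 = (\<lambda>n w. 0)"
| "inar_approx (Suc j) = (\<lambda>n w. w (Inl n) +
     (\<Sum>k<j. \<Sum>l = 1..inar_approx j (n - int (Suc k)) w. w (Inr (n, Suc k, l))))"

text \<open>The earlier populations (by induction) and the range of lags both grow with
  \<open>j\<close>, and all summands are naturals.\<close>

lemma inar_approx_Suc_mono: "inar_approx j n w \<le> inar_approx (Suc j) n w"
proof (induction j arbitrary: n)
  case (Suc j)
  have "(\<Sum>k<j. \<Sum>l = 1..inar_approx j (n - int (Suc k)) w. w (Inr (n, Suc k, l)))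
      \<le> (\<Sum>k<j. \<Sum>l = 1..inar_approx (Suc j) (n - int (Suc k)) w. w (Inr (n, Suc k, l)))"
    by (intro sum_mono sum_mono2) (use Suc.IH in \<open>auto intro: order_trans simp del: inar_approx.simps\<close>)
  also have "\<dots> \<le> (\<Sum>k<Suc j. \<Sum>l = 1..inar_approx (Suc j) (n - int (Suc k)) w. w (Inr (n, Suc k, l)))"
    by (intro sum_mono2) auto
  finally show ?case
    by (subst (1 2) inar_approx.simps(2)) (simp del: inar_approx.simps)
qed simp

lemma incseq_inar_approx: "incseq (\<lambda>j. inar_approx j n w)"
  by (intro incseq_SucI inar_approx_Suc_mono)

section \<open>Covariance under time shifts\<close>

definition innov_shift :: "int \<Rightarrow> int + int \<times> nat \<times> nat \<Rightarrow> int + int \<times> nat \<times> nat" where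
  "innov_shift h i = (case i of Inl n \<Rightarrow> Inl (n + h) | Inr (n, k, l) \<Rightarrow> Inr (n + h, k, l))"

lemma innov_shift_simps [simp]:
  "innov_shift h (Inl n) = Inl (n + h)" "innov_shift h (Inr (n, k, l)) = Inr (n + h, k, l)"
  by (simp_all add: innov_shift_def)

text \<open>The recursion sees time only through differences, so a shift of time can be moved into
  the configuration. Stationarity of the limit rests on this.\<close>

lemma inar_approx_shift: "inar_approx j (n + h) w = inar_approx j n (w \<circ> innov_shift h)"
proof (induction j arbitrary: n)
  case (Suc j)
  have "n + h - int (Suc k) = (n - int (Suc k)) + h" for k
    by simp
  then have "inar_approx j (n + h - int (Suc k)) w = inar_approx j (n - int (Suc k)) (w \<circ> innov_shift h)" for k
    using Suc[of "n - int (Suc k)"] by metis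
  then show ?case
    by (simp add: o_def)
qed simp

lemma inj_innov_shift: "inj (innov_shift h)"
  by (auto simp: inj_on_def innov_shift_def split: sum.splits)

lemma innov_shift_index: "i \<in> innov_index \<Longrightarrow> innov_shift h i \<in> innov_index"
  by (auto simp: innov_index_def)

section \<open>Dependence on the past, and measurability\<close>

definition innov_past :: "int \<Rightarrow> (int + int \<times> nat \<times> nat) set" where
  "innov_past n = (\<Union>m\<le>n. innov_index_at m)"

lemma innov_past_mono: "m \<le> n \<Longrightarrow> innov_past m \<subseteq> innov_past n"
  unfolding innov_past_def by (intro UN_mono) auto

lemma innov_past_subset: "innov_past n \<subseteq> innov_index"
  by (auto simp: innov_past_def innov_index_def innov_index_at_def)

lemma innov_index_at_subset: "innov_index_at n \<subseteq> innov_index"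
  by (auto simp: innov_index_def innov_index_at_def)

lemma Inl_in_innov_past: "Inl n \<in> innov_past n"
  by (auto simp: innov_past_def innov_index_at_def)

lemma Inr_in_innov_past: "k \<ge> 1 \<Longrightarrow> l \<ge> 1 \<Longrightarrow> Inr (n, k, l) \<in> innov_past n"
  by (auto simp: innov_past_def innov_index_at_def)

text \<open>The recursion only looks backwards in time. Restricting configurations to
  \<open>innov_past n\<close> is therefore harmless, which later yields measurability and
  independence.\<close>

lemma inar_approx_cong:
  assumes "\<And>i. i \<in> innov_past n \<Longrightarrow> w i = w' i"
  shows "inar_approx j n w = inar_approx j n w'"
  using assms
proof (induction j arbitrary: n)
  case (Suc j)
  have "inar_approx j (n - int (Suc k)) w = inar_approx j (n - int (Suc k)) w'" for k
    using Suc.prems innov_past_mono[of "n - int (Suc k)" n] by (intro Suc.IH) auto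
  then show ?case
    using Suc.prems[OF Inl_in_innov_past] Suc.prems[OF Inr_in_innov_past] by simp
qed simp

lemma measurable_add_nat:
  fixes f g :: "'a \<Rightarrow> nat"
  assumes f: "f \<in> N \<rightarrow>\<^sub>M count_space UNIV" and g: "g \<in> N \<rightarrow>\<^sub>M count_space UNIV"
  shows "(\<lambda>x. f x + g x) \<in> N \<rightarrow>\<^sub>M count_space UNIV"
  by (rule measurable_compose_countable[where f="\<lambda>i x. i + g x", OF measurable_compose[OF g] f]) simp

lemma measurable_inar_approx:
  assumes "innov_past n \<subseteq> J"
  shows "inar_approx j n \<in> Pi\<^sub>M J (\<lambda>_. count_space UNIV) \<rightarrow>\<^sub>M count_space UNIV"
  using assms
proof (induction j arbitrary: n)
  case (Suc j)
  have [measurable]: "inar_approx j (n - int (Suc k)) \<in> Pi\<^sub>M J (\<lambda>_. count_space UNIV) \<rightarrow>\<^sub>M count_space UNIV" for k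
    using Suc.prems innov_past_mono[of "n - int (Suc k)" n] by (intro Suc.IH) auto
  have immigration: "(\<lambda>w. w (Inl n) :: nat) \<in> Pi\<^sub>M J (\<lambda>_. count_space UNIV) \<rightarrow>\<^sub>M count_space UNIV"
    using Suc.prems Inl_in_innov_past by (intro measurable_component_singleton) auto
  have [measurable]: "(\<lambda>w. \<Sum>l = 1..z. w (Inr (n, Suc k, l)) :: nat) \<in> Pi\<^sub>M J (\<lambda>_. count_space UNIV) \<rightarrow>\<^sub>M count_space UNIV"
    for k and z :: nat
  proof (rule measurable_sum_nat)
    fix l assume "l \<in> {1..z}"
    then have "Inr (n, Suc k, l) \<in> J"
      using Suc.prems Inr_in_innov_past[of "Suc k" l n] by auto
    then show "(\<lambda>w. w (Inr (n, Suc k, l)) :: nat) \<in> Pi\<^sub>M J (\<lambda>_. count_space UNIV) \<rightarrow>\<^sub>M count_space UNIV"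
      by (rule measurable_component_singleton)
  qed
  \<comment> \<open>The number of summands is itself random; splitting on its countably many values
    \<open>z\<close> leaves sums of fixed length.\<close>
  have offspring: "(\<lambda>w. \<Sum>l = 1..inar_approx j (n - int (Suc k)) w. w (Inr (n, Suc k, l)))
      \<in> Pi\<^sub>M J (\<lambda>_. count_space UNIV) \<rightarrow>\<^sub>M count_space UNIV" for k
    by (rule measurable_compose_countable[where f="\<lambda>z w. \<Sum>l = 1..z. w (Inr (n, Suc k, l))"]) measurable
  show ?case
    unfolding inar_approx.simps by (intro measurable_add_nat measurable_sum_nat immigration offspring)
qed simp

text \<open>The supremum is junk where the iterates are unbounded; this will be a null set.\<close>

definition inar_limit :: "int \<Rightarrow> (int + int \<times> nat \<times> nat \<Rightarrow> nat) \<Rightarrow> nat" where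
  "inar_limit n w = (SUP j. inar_approx j n w)"

lemma inar_limit_shift: "inar_limit (n + h) w = inar_limit n (w \<circ> innov_shift h)"
  by (simp add: inar_limit_def inar_approx_shift)

lemma inar_limit_cong:
  assumes "\<And>i. i \<in> innov_past n \<Longrightarrow> w i = w' i"
  shows "inar_limit n w = inar_limit n w'"
  unfolding inar_limit_def by (intro SUP_cong refl inar_approx_cong assms)

lemma measurable_inar_limit:
  assumes "innov_past n \<subseteq> J"
  shows "inar_limit n \<in> Pi\<^sub>M J (\<lambda>_. count_space UNIV) \<rightarrow>\<^sub>M count_space UNIV"
proof -
  note [measurable] = measurable_inar_approx[OF assms]
  \<comment> \<open>A supremum of naturals is measurable once membership in the set is; here
    membership is a countable existential over \<open>j\<close>.\<close>
  have "(\<lambda>w. Sup (range (\<lambda>j. inar_approx j n w))) \<in> Pi\<^sub>M J (\<lambda>_. count_space UNIV) \<rightarrow>\<^sub>M count_space UNIV"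
    by (rule measurable_Sup_nat, unfold image_iff bex_UNIV) measurable
  then show ?thesis
    by (simp add: inar_limit_def[abs_def])
qed

text \<open>A bounded nonempty set of naturals attains its supremum, and monotonicity keeps all
  later iterates there.\<close>

lemma inar_approx_eventually_eq_limit:
  assumes "bdd_above (range (\<lambda>j. inar_approx j n w))"
  shows "\<forall>\<^sub>F j in sequentially. inar_approx j n w = inar_limit n w"
proof -
  have "inar_limit n w \<in> range (\<lambda>j. inar_approx j n w)"
    unfolding inar_limit_def using assms
    by (simp add: Sup_nat_def Max_in bdd_above_nat)
  then obtain j0 where j0: "inar_limit n w = inar_approx j0 n w"
    by auto
  have "inar_approx j n w = inar_limit n w" if "j \<ge> j0" for j
    using incseqD[OF incseq_inar_approx that, of n w] cSUP_upper[OF _ assms, of j] j0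
    by (simp add: inar_limit_def)
  then show ?thesis
    by (auto simp: eventually_sequentially)
qed

lemma inar_approx_le_limit:
  "bdd_above (range (\<lambda>j. inar_approx j n w)) \<Longrightarrow> inar_approx j n w \<le> inar_limit n w"
  unfolding inar_limit_def by (intro cSUP_upper) auto

text \<open>Each direction needs only finitely many lags: an iterate that has reached the limit uses
  finitely many, and the series is the supremum of its partial sums.\<close>

lemma inar_limit_equation:
  assumes bdd: "\<And>n. bdd_above (range (\<lambda>j. inar_approx j n w))"
  shows "(of_nat (inar_limit n w) :: ennreal) = of_nat (w (Inl n)) +
    (\<Sum>k. of_nat (\<Sum>l = 1..inar_limit (n - int (Suc k)) w. w (Inr (n, Suc k, l))))"
    (is "_ = _ + suminf ?f")
proof (rule antisym)
  \<comment> \<open>A successor index is chosen so that the recursion can be unfolded.\<close>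
  have "\<forall>\<^sub>F j in sequentially. inar_approx (Suc j) n w = inar_limit n w"
    using inar_approx_eventually_eq_limit[OF bdd]
    by (subst eventually_sequentially_Suc)
  then obtain j where j: "inar_approx (Suc j) n w = inar_limit n w"
    by (meson eventually_happens trivial_limit_sequentially)
  have "of_nat (\<Sum>k<j. \<Sum>l = 1..inar_approx j (n - int (Suc k)) w. w (Inr (n, Suc k, l))) \<le> (\<Sum>k<j. ?f k)"
    unfolding of_nat_sum[symmetric] of_nat_le_iff
    by (intro sum_mono sum_mono2) (use inar_approx_le_limit[OF bdd] in \<open>auto intro: order_trans\<close>)
  also have "\<dots> \<le> suminf ?f"
    by (rule sum_le_suminf) auto
  finally show "of_nat (inar_limit n w) \<le> of_nat (w (Inl n)) + suminf ?f"
    unfolding j[symmetric] by simp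
next
  have "of_nat (w (Inl n)) + (\<Sum>k<K. ?f k) \<le> of_nat (inar_limit n w)" for K
  proof -
    \<comment> \<open>One \<open>j\<close> must serve two purposes: the truncation admits the first
      \<open>K\<close> lags, and the populations at those lags have all stabilised.\<close>
    have "\<forall>\<^sub>F j in sequentially. j \<ge> K \<and>
        (\<forall>k\<in>{..<K}. inar_approx j (n - int (Suc k)) w = inar_limit (n - int (Suc k)) w)"
      by (intro eventually_conj eventually_ge_at_top eventually_ball_finite ballI
            inar_approx_eventually_eq_limit bdd) auto
    then obtain j where j: "j \<ge> K"
        "\<And>k. k < K \<Longrightarrow> inar_approx j (n - int (Suc k)) w = inar_limit (n - int (Suc k)) w"
      by (auto dest: eventually_happens)
    have "w (Inl n) + (\<Sum>k<K. \<Sum>l = 1..inar_limit (n - int (Suc k)) w. w (Inr (n, Suc k, l)))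
        = w (Inl n) + (\<Sum>k<K. \<Sum>l = 1..inar_approx j (n - int (Suc k)) w. w (Inr (n, Suc k, l)))"
      using j(2) by simp
    also have "\<dots> \<le> inar_approx (Suc j) n w"
      using j(1) by (auto intro!: sum_mono2)
    also have "\<dots> \<le> inar_limit n w"
      by (rule inar_approx_le_limit[OF bdd])
    finally show ?thesis
      unfolding of_nat_sum[symmetric] of_nat_add[symmetric] of_nat_le_iff .
  qed
  then have "(SUP K. of_nat (w (Inl n)) + (\<Sum>k<K. ?f k)) \<le> of_nat (inar_limit n w)"
    by (intro SUP_least)
  then show "of_nat (w (Inl n)) + suminf ?f \<le> of_nat (inar_limit n w)"
    by (simp add: suminf_eq_SUP ennreal_SUP_add_right)
qed

section \<open>Exponential moments of the iterates\<close>

lemma nn_integral_exp_pois_pmf: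
  assumes "r \<ge> 0"
  shows "(\<integral>\<^sup>+ x. ennreal (exp (s * real x)) \<partial>measure_pmf (pois_pmf r)) = ennreal (exp ((exp s - 1) * r))"
proof (cases "r = 0")
  case False
  then have r: "r > 0"
    using assms by simp
  have "(\<lambda>x. (r * exp s) ^ x / fact x) sums exp (r * exp s)"
    using exp_converges[of "r * exp s"] by (simp add: field_simps)
  from sums_mult[OF this, of "exp (- r)"]
  have sums: "(\<lambda>x. pmf (poisson_pmf r) x * exp (s * real x)) sums exp ((exp s - 1) * r)"
    using r by (simp add: mult_ac power_mult_distrib exp_of_nat_mult[symmetric] algebra_simps exp_diff exp_minus divide_inverse)
  have "(\<integral>\<^sup>+ x. ennreal (exp (s * real x)) \<partial>measure_pmf (pois_pmf r)) =
      (\<Sum>x. ennreal (pmf (poisson_pmf r) x * exp (s * real x)))"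
    using False by (simp add: pois_pmf_def nn_integral_measure_pmf nn_integral_count_space_nat ennreal_mult' pmf_nonneg)
  also have "\<dots> = ennreal (exp ((exp s - 1) * r))"
    by (rule suminf_ennreal_eq[OF _ sums]) (simp add: pmf_nonneg)
  finally show ?thesis .
qed (simp add: pois_pmf_def nn_integral_return_pmf)

text \<open>Tonelli for the product law of \<open>(U, V)\<close>. It replaces conditioning on
  \<open>V\<close>: the inner integral treats \<open>V \<omega>'\<close> as frozen.\<close>

lemma (in prob_space) nn_integral_indep_var:
  assumes indep: "indep_var S U T V"
    and f: "case_prod f \<in> borel_measurable (S \<Otimes>\<^sub>M T)"
  shows "(\<integral>\<^sup>+ \<omega>. f (U \<omega>) (V \<omega>) \<partial>M) = (\<integral>\<^sup>+ \<omega>'. (\<integral>\<^sup>+ \<omega>. f (U \<omega>) (V \<omega>') \<partial>M) \<partial>M)"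
proof -
  have U[measurable]: "U \<in> M \<rightarrow>\<^sub>M S" and V[measurable]: "V \<in> M \<rightarrow>\<^sub>M T"
    using indep by (auto dest: indep_var_rv1 indep_var_rv2)
  have law: "distr M S U \<Otimes>\<^sub>M distr M T V = distr M (S \<Otimes>\<^sub>M T) (\<lambda>x. (U x, V x))"
    using indep by (simp add: indep_var_distribution_eq)
  interpret U: prob_space "distr M S U"
    by (rule prob_space_distr[OF U])
  interpret V: prob_space "distr M T V"
    by (rule prob_space_distr[OF V])
  interpret UV: pair_prob_space "distr M S U" "distr M T V" ..
  note f[measurable]
  have "(\<integral>\<^sup>+ \<omega>. f (U \<omega>) (V \<omega>) \<partial>M) = integral\<^sup>N (distr M S U \<Otimes>\<^sub>M distr M T V) (case_prod f)"
    unfolding law by (subst nn_integral_distr) auto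
  also have "\<dots> = (\<integral>\<^sup>+ v. (\<integral>\<^sup>+ u. f u v \<partial>distr M S U) \<partial>distr M T V)"
    by (subst UV.nn_integral_snd[symmetric]) auto
  also have "\<dots> = (\<integral>\<^sup>+ \<omega>'. (\<integral>\<^sup>+ u. f u (V \<omega>') \<partial>distr M S U) \<partial>M)"
    by (rule nn_integral_distr) measurable
  also have "\<dots> = (\<integral>\<^sup>+ \<omega>'. (\<integral>\<^sup>+ \<omega>. f (U \<omega>) (V \<omega>') \<partial>M) \<partial>M)"
  proof (rule nn_integral_cong)
    fix \<omega>' assume "\<omega>' \<in> space M"
    then have [measurable]: "V \<omega>' \<in> space T"
      by (rule measurable_space[OF V])
    show "(\<integral>\<^sup>+ u. f u (V \<omega>') \<partial>distr M S U) = (\<integral>\<^sup>+ \<omega>. f (U \<omega>) (V \<omega>') \<partial>M)"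
      by (rule nn_integral_distr) measurable
  qed
  finally show ?thesis .
qed

section \<open>The innovation field: laws and independence\<close>

locale inar_innovation_space = prob_space M
  for M :: "'a measure" +
  fixes \<alpha> :: "nat \<Rightarrow> real" and eps :: "int \<Rightarrow> 'a \<Rightarrow> nat" and xi :: "int \<Rightarrow> nat \<Rightarrow> nat \<Rightarrow> 'a \<Rightarrow> nat"
  assumes nonneg: "\<And>k. \<alpha> k \<ge> 0"
    and innovations: "inar_innovations M \<alpha> eps xi"
begin

text \<open>Measurability is known only for coordinates in \<open>innov_index\<close>; hence the
  repeated restrictions of \<open>W \<omega>\<close> below.\<close>

abbreviation W :: "'a \<Rightarrow> int + int \<times> nat \<times> nat \<Rightarrow> nat" where
  "W \<omega> \<equiv> (\<lambda>i. innov eps xi i \<omega>)"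

lemma indep_innov: "indep_vars (\<lambda>_. count_space UNIV) (innov eps xi) innov_index"
  using innovations by (simp add: inar_innovations_def)

lemma measurable_innov: "i \<in> innov_index \<Longrightarrow> innov eps xi i \<in> M \<rightarrow>\<^sub>M count_space UNIV"
  using indep_innov by (simp add: indep_vars_def)

lemma distr_innov:
  assumes "i \<in> innov_index"
  shows "distr M (count_space UNIV) (innov eps xi i) =
    measure_pmf (pois_pmf (case i of Inl n \<Rightarrow> \<alpha> 0 | Inr (n, k, l) \<Rightarrow> \<alpha> k))"
  using assms innovations
  by (auto simp: inar_innovations_def innov_def innov_index_def split: sum.split)

lemma measurable_restrict_innov:
  "J \<subseteq> innov_index \<Longrightarrow> (\<lambda>\<omega>. restrict (W \<omega>) J) \<in> M \<rightarrow>\<^sub>M Pi\<^sub>M J (\<lambda>_. count_space UNIV)"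
  by (intro measurable_restrict measurable_innov) auto

lemma nn_integral_exp_innov:
  assumes "i \<in> innov_index"
  shows "(\<integral>\<^sup>+ \<omega>. ennreal (exp (s * real (W \<omega> i))) \<partial>M) =
    ennreal (exp ((exp s - 1) * (case i of Inl n \<Rightarrow> \<alpha> 0 | Inr (n, k, l) \<Rightarrow> \<alpha> k)))"
proof -
  have "(\<integral>\<^sup>+ \<omega>. ennreal (exp (s * real (W \<omega> i))) \<partial>M) =
      (\<integral>\<^sup>+ x. ennreal (exp (s * real x)) \<partial>distr M (count_space UNIV) (innov eps xi i))"
    by (subst nn_integral_distr[OF measurable_innov[OF assms]]) auto
  then show ?thesis
    unfolding distr_innov[OF assms]
    by (subst (asm) nn_integral_exp_pois_pmf) (auto simp: nonneg split: sum.split prod.split)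
qed

text \<open>With population sizes \<open>z\<close> frozen, the exponent is a sum over a finite set
  of independent Poisson variables, so the expectation factors and the rates add up.\<close>

lemma nn_integral_exp_offspring:
  fixes z :: "nat \<Rightarrow> nat"
  shows "(\<integral>\<^sup>+ \<omega>. ennreal (exp (s * real (W \<omega> (Inl n) + (\<Sum>k<j. \<Sum>l = 1..z k. W \<omega> (Inr (n, Suc k, l)))))) \<partial>M) =
    ennreal (exp ((exp s - 1) * (\<alpha> 0 + (\<Sum>k<j. \<alpha> (Suc k) * real (z k)))))"
proof -
  \<comment> \<open>\<open>K\<close> lists the pairs of shifted lag and individual, \<open>g\<close>
    embeds them as indices, and \<open>I\<close> collects all innovations occurring in the
    sum.\<close>
  define K where "K = (SIGMA k:{..<j}. {1..z k})"
  define g :: "nat \<times> nat \<Rightarrow> int + int \<times> nat \<times> nat" where "g = (\<lambda>(k, l). Inr (n, Suc k, l))"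
  define I where "I = insert (Inl n) (g ` K)"
  have fin: "finite K" "finite I"
    by (auto simp: K_def I_def)
  have I: "I \<subseteq> innov_index"
    by (auto simp: I_def K_def g_def innov_index_def)
  have notin: "Inl n \<notin> g ` K" and inj: "inj_on g K"
    by (auto simp: g_def inj_on_def)
  have sum_I: "sum f I = f (Inl n) + (\<Sum>k<j. \<Sum>l = 1..z k. f (Inr (n, Suc k, l)))"
    for f :: "_ \<Rightarrow> 'b::comm_monoid_add"
  proof -
    have "sum f I = f (Inl n) + (\<Sum>x\<in>K. f (g x))"
      using fin notin by (simp add: I_def sum.reindex[OF inj])
    also have "(\<Sum>x\<in>K. f (g x)) = (\<Sum>k<j. \<Sum>l = 1..z k. f (Inr (n, Suc k, l)))"
      unfolding K_def by (subst sum.Sigma) (auto simp: g_def intro!: sum.cong)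
    finally show ?thesis .
  qed
  have "(\<integral>\<^sup>+ \<omega>. ennreal (exp (s * real (W \<omega> (Inl n) + (\<Sum>k<j. \<Sum>l = 1..z k. W \<omega> (Inr (n, Suc k, l)))))) \<partial>M)
      = (\<integral>\<^sup>+ \<omega>. (\<Prod>i\<in>I. ennreal (exp (s * real (W \<omega> i)))) \<partial>M)"
  proof -
    have "real (W \<omega> (Inl n) + (\<Sum>k<j. \<Sum>l = 1..z k. W \<omega> (Inr (n, Suc k, l)))) = (\<Sum>i\<in>I. real (W \<omega> i))" for \<omega>
      by (simp add: sum_I)
    then show ?thesis
      by (simp only:) (simp add: prod_ennreal exp_sum[OF fin(2), symmetric] sum_distrib_left)
  qed
  also have "\<dots> = (\<Prod>i\<in>I. \<integral>\<^sup>+ \<omega>. ennreal (exp (s * real (W \<omega> i))) \<partial>M)"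
    by (rule indep_vars_nn_integral[OF fin(2)])
      (auto intro!: indep_vars_compose2[OF indep_vars_subset[OF indep_innov I]])
  also have "\<dots> = (\<Prod>i\<in>I. ennreal (exp ((exp s - 1) * (case i of Inl n \<Rightarrow> \<alpha> 0 | Inr (n, k, l) \<Rightarrow> \<alpha> k))))"
    using I by (intro prod.cong refl nn_integral_exp_innov) auto
  also have "\<dots> = ennreal (exp ((exp s - 1) * (\<Sum>i\<in>I. case i of Inl n \<Rightarrow> \<alpha> 0 | Inr (n, k, l) \<Rightarrow> \<alpha> k)))"
    by (simp add: prod_ennreal exp_sum[OF fin(2), symmetric] sum_distrib_left)
  also have "(\<Sum>i\<in>I. case i of Inl n \<Rightarrow> \<alpha> 0 | Inr (n, k, l) \<Rightarrow> \<alpha> k) =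
      \<alpha> 0 + (\<Sum>k<j. \<alpha> (Suc k) * real (z k))"
    by (simp add: sum_I mult.commute)
  finally show ?thesis .
qed

text \<open>The two index blocks are disjoint since the past stops at \<open>n - 1\<close>.\<close>

lemma indep_innov_at_past:
  "indep_var (Pi\<^sub>M (innov_index_at n) (\<lambda>_. count_space UNIV)) (\<lambda>\<omega>. restrict (W \<omega>) (innov_index_at n))
     (Pi\<^sub>M (innov_past (n - 1)) (\<lambda>_. count_space UNIV)) (\<lambda>\<omega>. restrict (W \<omega>) (innov_past (n - 1)))"
proof (rule indep_var_restrict[OF indep_innov _ innov_index_at_subset innov_past_subset])
  show "innov_index_at n \<inter> innov_past (n - 1) = {}"
    by (auto simp: innov_past_def innov_index_at_def)
qed

lemma inar_approx_restrict_past: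
  assumes "m \<le> n"
  shows "inar_approx j m (restrict w (innov_past n)) = inar_approx j m w"
  using innov_past_mono[OF assms] by (intro inar_approx_cong) auto

lemma inar_limit_restrict_past:
  assumes "m \<le> n"
  shows "inar_limit m (restrict w (innov_past n)) = inar_limit m w"
  using innov_past_mono[OF assms] by (intro inar_limit_cong) auto

text \<open>The populations feeding generation \<open>Suc j\<close> are functions of the strict
  past, so the innovations at time \<open>n\<close> can be integrated out with these populations
  frozen.\<close>

lemma nn_integral_exp_inar_approx_Suc:
  "(\<integral>\<^sup>+ \<omega>. ennreal (exp (s * real (inar_approx (Suc j) n (W \<omega>)))) \<partial>M) =
   (\<integral>\<^sup>+ \<omega>. ennreal (exp ((exp s - 1) *
      (\<alpha> 0 + (\<Sum>k<j. \<alpha> (Suc k) * real (inar_approx j (n - int (Suc k)) (W \<omega>)))))) \<partial>M)"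
proof -
  let ?A = "innov_index_at n" and ?B = "innov_past (n - 1)"
  let ?S = "Pi\<^sub>M ?A (\<lambda>_. count_space UNIV) :: (_ \<Rightarrow> nat) measure"
  let ?T = "Pi\<^sub>M ?B (\<lambda>_. count_space UNIV) :: (_ \<Rightarrow> nat) measure"
  \<comment> \<open>\<open>h\<close> separates the two sources of randomness: \<open>u\<close>
    carries the innovations at time \<open>n\<close>, and \<open>z\<close> the population sizes,
    supplied by \<open>Z\<close> from the past.\<close>
  define h :: "(int + int \<times> nat \<times> nat \<Rightarrow> nat) \<Rightarrow> (nat \<Rightarrow> nat) \<Rightarrow> ennreal" where
    "h u z = ennreal (exp (s * real (u (Inl n) + (\<Sum>k<j. \<Sum>l = 1..z k. u (Inr (n, Suc k, l))))))" for u z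
  define Z where "Z v k = inar_approx j (n - int (Suc k)) v" for v k
  have "Inl n \<in> ?A" "l \<ge> 1 \<Longrightarrow> Inr (n, Suc k, l) \<in> ?A" for k l
    by (auto simp: innov_index_at_def)
  then have restrict_A: "h (restrict w ?A) z = h w z" for w z
    by (simp add: h_def)
  have restrict_B: "Z (restrict w ?B) = Z w" for w
    by (simp add: Z_def fun_eq_iff inar_approx_restrict_past)
  have "(\<lambda>v. Z v k) \<in> ?T \<rightarrow>\<^sub>M count_space UNIV" for k
    unfolding Z_def by (intro measurable_inar_approx innov_past_mono) auto
  then have [measurable]: "(\<lambda>p. Z (snd p) k) \<in> ?S \<Otimes>\<^sub>M ?T \<rightarrow>\<^sub>M count_space UNIV" for k
    by measurable
  have "(\<lambda>u. u (Inl n)) \<in> ?S \<rightarrow>\<^sub>M count_space UNIV"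
    by (rule measurable_component_singleton) (auto simp: innov_index_at_def)
  then have [measurable]: "(\<lambda>p. fst p (Inl n)) \<in> ?S \<Otimes>\<^sub>M ?T \<rightarrow>\<^sub>M count_space UNIV"
    by measurable
  have [measurable]: "(\<lambda>p. \<Sum>l = 1..z. fst p (Inr (n, Suc k, l))) \<in> ?S \<Otimes>\<^sub>M ?T \<rightarrow>\<^sub>M count_space UNIV"
    for k and z :: nat
  proof (rule measurable_sum_nat)
    fix l assume "l \<in> {1..z}"
    then have "(\<lambda>u. u (Inr (n, Suc k, l))) \<in> ?S \<rightarrow>\<^sub>M count_space UNIV"
      by (intro measurable_component_singleton) (auto simp: innov_index_at_def)
    then show "(\<lambda>p. fst p (Inr (n, Suc k, l))) \<in> ?S \<Otimes>\<^sub>M ?T \<rightarrow>\<^sub>M count_space UNIV"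
      by measurable
  qed
  have [measurable]: "(\<lambda>p. \<Sum>l = 1..Z (snd p) k. fst p (Inr (n, Suc k, l))) \<in> ?S \<Otimes>\<^sub>M ?T \<rightarrow>\<^sub>M count_space UNIV" for k
    by (rule measurable_compose_countable[where f="\<lambda>z p. \<Sum>l = 1..z. fst p (Inr (n, Suc k, l))"]) measurable
  have meas: "(\<lambda>(u, v). h u (Z v)) \<in> borel_measurable (?S \<Otimes>\<^sub>M ?T)"
    unfolding h_def case_prod_beta by measurable
  have "(\<integral>\<^sup>+ \<omega>. ennreal (exp (s * real (inar_approx (Suc j) n (W \<omega>)))) \<partial>M)
      = (\<integral>\<^sup>+ \<omega>. h (restrict (W \<omega>) ?A) (Z (restrict (W \<omega>) ?B)) \<partial>M)"
    by (simp only: restrict_A restrict_B) (simp only: h_def Z_def inar_approx.simps(2))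
  also have "\<dots> = (\<integral>\<^sup>+ \<omega>'. (\<integral>\<^sup>+ \<omega>. h (restrict (W \<omega>) ?A) (Z (restrict (W \<omega>') ?B)) \<partial>M) \<partial>M)"
    by (rule nn_integral_indep_var[OF indep_innov_at_past meas])
  finally show ?thesis
    by (simp only: restrict_A restrict_B) (simp only: h_def Z_def nn_integral_exp_offspring)
qed

text \<open>A fixed-point argument for the log-Laplace transform: since \<open>exp s - 1 \<le> (1 + s) * s\<close> for
  \<open>s \<le> 1\<close>, one generation replaces \<open>s\<close> by \<open>\<rho> * s\<close> with \<open>\<rho> < 1\<close>, up to a factor \<open>exp (2 * \<alpha> 0 * s)\<close>.
  The Poisson mixture over the lags is reduced to a single lag by convexity of \<open>exp\<close>.\<close>

lemma nn_integral_exp_inar_approx_le: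
  fixes a :: real
  assumes a: "\<And>j. (\<Sum>k<j. \<alpha> (Suc k)) \<le> a" "a < 1" and s: "0 < s" "s \<le> (1 - a) / 2"
  shows "(\<integral>\<^sup>+ \<omega>. ennreal (exp (s * real (inar_approx j n (W \<omega>)))) \<partial>M)
    \<le> ennreal (exp (4 * \<alpha> 0 / (1 - a) * s))"
  using s
proof (induction j arbitrary: n s)
  case 0
  have "0 \<le> 4 * \<alpha> 0 / (1 - a) * s"
    using 0 a(2) nonneg[of 0] by simp
  then have "ennreal 1 \<le> ennreal (exp (4 * \<alpha> 0 / (1 - a) * s))"
    by (intro ennreal_leI) simp
  then show ?case
    by (simp add: emeasure_space_1)
next
  case (Suc j)
  have a0: "a \<ge> 0"
    using a(1)[of 0] by simp
  \<comment> \<open>\<open>\<rho>\<close> is the midpoint of \<open>a\<close> and \<open>1\<close>,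
    and \<open>C\<close> solves \<open>2 * \<alpha> 0 + C * \<rho> = C\<close>, which closes the
    induction.\<close>
  define C where "C = 4 * \<alpha> 0 / (1 - a)"
  define \<rho> where "\<rho> = (1 + a) / 2"
  define t where "t = exp s - 1"
  \<comment> \<open>Weights chosen so that the exponent becomes a combination of the values
    \<open>\<rho> * s * Z \<omega> k\<close>; their total is at most \<open>1\<close> by the bound
    on \<open>t\<close>.\<close>
  define v where "v k = t * \<alpha> (Suc k) / (\<rho> * s)" for k
  define Z where "Z \<omega> k = real (inar_approx j (n - int (Suc k)) (W \<omega>))" for \<omega> k
  have \<rho>: "0 < \<rho>" "\<rho> < 1"
    using a(2) a0 by (auto simp: \<rho>_def)
  have C: "C \<ge> 0"
    using a(2) nonneg[of 0] by (simp add: C_def)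
  have s1: "s \<le> 1"
    using Suc.prems a0 by simp
  have t0: "t \<ge> 0"
    using Suc.prems by (simp add: t_def)
  have t: "t \<le> (1 + s) * s"
    using exp_bound[of s] Suc.prems s1 by (simp add: t_def power2_eq_square algebra_simps)
  also have "\<dots> \<le> 2 * s"
    using s1 Suc.prems by (intro mult_right_mono) auto
  finally have t2: "t \<le> 2 * s" .
  have "(1 + s) * a \<le> \<rho>"
  proof -
    have "s * a \<le> s"
      using a(2) Suc.prems by (simp add: mult_left_le)
    then have "(1 + s) * a \<le> a + s"
      by (simp add: distrib_right)
    \<comment> \<open>This is where \<open>s \<le> (1 - a) / 2\<close> is used:
      \<open>a + (1 - a) / 2 = \<rho>\<close>.\<close>
    also have "\<dots> \<le> \<rho>"
      using Suc.prems by (simp add: \<rho>_def field_simps)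
    finally show ?thesis .
  qed
  then have "(1 + s) * a * s \<le> \<rho> * s"
    using Suc.prems by (intro mult_right_mono) auto
  moreover have "t * a \<le> (1 + s) * a * s"
    using mult_right_mono[OF t a0] by (simp only: mult_ac)
  ultimately have "t * a \<le> \<rho> * s"
    by (rule order_trans[rotated])
  moreover have "(\<Sum>k<j. v k) = t * (\<Sum>k<j. \<alpha> (Suc k)) / (\<rho> * s)"
    by (simp add: v_def sum_distrib_left sum_divide_distrib)
  ultimately have v1: "(\<Sum>k<j. v k) \<le> 1"
    using mult_left_mono[OF a(1)[of j] t0] \<rho> Suc.prems by (simp add: divide_le_eq)
  have v0: "v k \<ge> 0" for k
    using t0 nonneg \<rho> Suc.prems by (simp add: v_def)
  have v_sum: "t * (\<Sum>k<j. \<alpha> (Suc k) * Z \<omega> k) = (\<Sum>k<j. v k * (\<rho> * s * Z \<omega> k))" for \<omega>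
    using \<rho> Suc.prems by (simp add: v_def sum_distrib_left mult_ac)
  have pointwise: "exp (t * (\<alpha> 0 + (\<Sum>k<j. \<alpha> (Suc k) * Z \<omega> k)))
      \<le> exp (t * \<alpha> 0) * ((\<Sum>k<j. v k * exp (\<rho> * s * Z \<omega> k)) + (1 - (\<Sum>k<j. v k)))" for \<omega>
  proof -
    \<comment> \<open>Jensen needs total weight \<open>1\<close>, so an extra slot \<open>j\<close>
      places the missing mass at the point \<open>0\<close>, where \<open>exp\<close> equals
      \<open>1\<close>.\<close>
    have "exp (\<Sum>k\<in>{..j}. (if k < j then v k else 1 - (\<Sum>k<j. v k)) *\<^sub>R (if k < j then \<rho> * s * Z \<omega> k else 0))
       \<le> (\<Sum>k\<in>{..j}. (if k < j then v k else 1 - (\<Sum>k<j. v k)) * exp (if k < j then \<rho> * s * Z \<omega> k else 0))"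
      using v0 v1 convex_on_exp[of 1]
      by (intro convex_on_sum[where C=UNIV]) (auto simp: lessThan_Suc_atMost[symmetric])
    then have "exp (\<Sum>k<j. v k * (\<rho> * s * Z \<omega> k)) \<le> (\<Sum>k<j. v k * exp (\<rho> * s * Z \<omega> k)) + (1 - (\<Sum>k<j. v k))"
      by (simp add: lessThan_Suc_atMost[symmetric] cong: if_cong)
    from mult_left_mono[OF this, of "exp (t * \<alpha> 0)"] show ?thesis
      by (simp only: distrib_left[of t] exp_add v_sum exp_ge_zero)
  qed
  \<comment> \<open>Transfer between \<open>ennreal\<close> and real mixtures; used with
    \<open>y = 1\<close> before the induction hypothesis and with
    \<open>y = exp (C * (\<rho> * s))\<close> after it.\<close>
  have mixture: "ennreal b * ((\<Sum>k<j. ennreal (v k) * ennreal (x k)) + ennreal (1 - (\<Sum>k<j. v k)) * ennreal y)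
      = ennreal (b * ((\<Sum>k<j. v k * x k) + (1 - (\<Sum>k<j. v k)) * y))"
    if "b \<ge> 0" "\<And>k. x k \<ge> 0" "y \<ge> 0" for b y :: real and x :: "nat \<Rightarrow> real"
    using that v0 v1
    by (simp add: ennreal_mult[symmetric] ennreal_plus[symmetric] sum_nonneg del: ennreal_plus)
  have "\<rho> * s \<le> s"
    using \<rho> Suc.prems by (intro mult_left_le_one_le) auto
  then have \<rho>s: "0 < \<rho> * s" "\<rho> * s \<le> (1 - a) / 2"
    using \<rho> Suc.prems(1) order_trans[OF _ Suc.prems(2)] by simp_all
  have [measurable]: "(\<lambda>\<omega>. Z \<omega> k) \<in> borel_measurable M" for k
  proof -
    have "(\<lambda>\<omega>. inar_approx j (n - int (Suc k)) (restrict (W \<omega>) (innov_past n))) \<in> M \<rightarrow>\<^sub>M count_space UNIV"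
      by (rule measurable_compose[OF measurable_restrict_innov[OF innov_past_subset] measurable_inar_approx])
        (rule innov_past_mono, simp)
    then show ?thesis
      by (simp add: Z_def inar_approx_restrict_past)
  qed
  have "(\<integral>\<^sup>+ \<omega>. ennreal (exp (s * real (inar_approx (Suc j) n (W \<omega>)))) \<partial>M)
      = (\<integral>\<^sup>+ \<omega>. ennreal (exp (t * (\<alpha> 0 + (\<Sum>k<j. \<alpha> (Suc k) * Z \<omega> k)))) \<partial>M)"
    unfolding nn_integral_exp_inar_approx_Suc t_def Z_def ..
  also have "\<dots> \<le> (\<integral>\<^sup>+ \<omega>. ennreal (exp (t * \<alpha> 0)) * ((\<Sum>k<j. ennreal (v k) * ennreal (exp (\<rho> * s * Z \<omega> k)))
      + ennreal (1 - (\<Sum>k<j. v k))) \<partial>M)"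
    using ennreal_leI[OF pointwise] mixture[of "exp (t * \<alpha> 0)" _ 1] by (intro nn_integral_mono) simp
  also have "\<dots> = ennreal (exp (t * \<alpha> 0)) * ((\<Sum>k<j. ennreal (v k) * (\<integral>\<^sup>+ \<omega>. ennreal (exp (\<rho> * s * Z \<omega> k)) \<partial>M))
      + ennreal (1 - (\<Sum>k<j. v k)))"
    by (simp add: nn_integral_cmult nn_integral_add nn_integral_sum emeasure_space_1)
  also have "\<dots> \<le> ennreal (exp (t * \<alpha> 0)) * ((\<Sum>k<j. ennreal (v k) * ennreal (exp (C * (\<rho> * s))))
      + ennreal (1 - (\<Sum>k<j. v k)) * ennreal (exp (C * (\<rho> * s))))"
  proof (intro mult_left_mono add_mono sum_mono)
    show "(\<integral>\<^sup>+ \<omega>. ennreal (exp (\<rho> * s * Z \<omega> k)) \<partial>M) \<le> ennreal (exp (C * (\<rho> * s)))" for k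
      unfolding Z_def C_def by (rule Suc.IH[OF \<rho>s])
    \<comment> \<open>Enlarging the missing mass by this factor gives every term the same
      exponential, so the weights sum to \<open>1\<close> and disappear.\<close>
    have "1 \<le> exp (C * (\<rho> * s))"
      using C \<rho>s by simp
    then show "ennreal (1 - (\<Sum>k<j. v k)) \<le> ennreal (1 - (\<Sum>k<j. v k)) * ennreal (exp (C * (\<rho> * s)))"
      using v1 by (subst ennreal_mult[symmetric]) (auto intro!: ennreal_leI mult_right_mono simp: mult_le_cancel_left1)
  qed auto
  also have "\<dots> = ennreal (exp (t * \<alpha> 0) * ((\<Sum>k<j. v k * exp (C * (\<rho> * s)))
      + (1 - (\<Sum>k<j. v k)) * exp (C * (\<rho> * s))))"
    by (rule mixture) auto
  also have "\<dots> = ennreal (exp (t * \<alpha> 0 + C * (\<rho> * s)))"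
    by (simp add: sum_distrib_right[symmetric] distrib_right[symmetric] exp_add)
  also have "\<dots> \<le> ennreal (exp (C * s))"
  proof -
    have "t * \<alpha> 0 \<le> 2 * s * \<alpha> 0"
      by (rule mult_right_mono[OF t2 nonneg])
    moreover have "2 * s * \<alpha> 0 + C * (\<rho> * s) = C * s"
      using a(2) by (simp add: C_def \<rho>_def field_simps)
    ultimately show ?thesis
      by (intro ennreal_leI) simp
  qed
  finally show ?case
    by (simp add: C_def)
qed

end

section \<open>The stationary solution\<close>

text \<open>Passes from the generated sigma-algebras of \<open>indep_var\<close> to the plain
  preimage families in \<open>inar_causal\<close>.\<close>

lemma (in prob_space) indep_set_mono:
  "indep_set A B \<Longrightarrow> A' \<subseteq> A \<Longrightarrow> B' \<subseteq> B \<Longrightarrow> indep_set A' B'"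
  unfolding indep_sets2_eq by blast

context inar_innovation_space
begin

section \<open>Stationarity and causality of the limit\<close>

lemma measurable_inar_limit_innov: "(\<lambda>\<omega>. inar_limit n (W \<omega>)) \<in> M \<rightarrow>\<^sub>M count_space UNIV"
proof -
  have "(\<lambda>\<omega>. inar_limit n (restrict (W \<omega>) (innov_past n))) \<in> M \<rightarrow>\<^sub>M count_space UNIV"
    by (rule measurable_compose[OF measurable_restrict_innov[OF innov_past_subset] measurable_inar_limit]) simp
  then show ?thesis
    by (simp add: inar_limit_restrict_past)
qed

lemma measurable_inar_approx_innov: "(\<lambda>\<omega>. inar_approx j n (W \<omega>)) \<in> M \<rightarrow>\<^sub>M count_space UNIV"
proof -
  have "(\<lambda>\<omega>. inar_approx j n (restrict (W \<omega>) (innov_past n))) \<in> M \<rightarrow>\<^sub>M count_space UNIV"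
    by (rule measurable_compose[OF measurable_restrict_innov[OF innov_past_subset] measurable_inar_approx]) simp
  then show ?thesis
    by (simp add: inar_approx_restrict_past)
qed

text \<open>The joint law of the innovations is a product measure whose marginals do not depend on
  time, hence shift invariant; the limit commutes with shifts.\<close>

lemma strictly_stationary_inar_limit: "strictly_stationary M (\<lambda>n \<omega>. inar_limit n (W \<omega>))"
  unfolding strictly_stationary_def
proof
  fix h
  let ?I = innov_index
  let ?N = "Pi\<^sub>M ?I (\<lambda>_. count_space UNIV) :: (_ \<Rightarrow> nat) measure"
  let ?P = "Pi\<^sub>M UNIV (\<lambda>_. count_space UNIV) :: (int \<Rightarrow> nat) measure"
  let ?L = "\<lambda>w n. inar_limit n w"
  have ne: "?I \<noteq> {}"
    by (auto simp: innov_index_def)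
  define \<nu> where "\<nu> i = distr M (count_space UNIV) (innov eps xi i)" for i
  have \<nu>: "prob_space (\<nu> i)" "\<nu> (innov_shift h i) = \<nu> i" if "i \<in> ?I" for i
  proof -
    show "prob_space (\<nu> i)"
      unfolding \<nu>_def by (rule prob_space_distr[OF measurable_innov[OF that]])
    show "\<nu> (innov_shift h i) = \<nu> i"
      by (simp only: \<nu>_def distr_innov that innov_shift_index)
        (simp add: innov_shift_def split: sum.split prod.split)
  qed
  have [measurable]: "(\<lambda>\<omega>. \<lambda>i\<in>?I. W \<omega> (innov_shift h i)) \<in> M \<rightarrow>\<^sub>M ?N" "(\<lambda>\<omega>. \<lambda>i\<in>?I. W \<omega> i) \<in> M \<rightarrow>\<^sub>M ?N"
    using measurable_innov innov_shift_index by (auto intro!: measurable_restrict)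
  have sh[measurable]: "(\<lambda>w. \<lambda>i\<in>?I. w (innov_shift h i)) \<in> ?N \<rightarrow>\<^sub>M ?N"
    by (intro measurable_restrict measurable_component_singleton innov_shift_index)
  have Pi: "distr M ?N (\<lambda>\<omega>. \<lambda>i\<in>?I. W \<omega> i) = Pi\<^sub>M ?I \<nu>"
    using indep_innov unfolding \<nu>_def[abs_def]
    by (subst (asm) indep_vars_iff_distr_eq_PiM') (use ne in \<open>auto intro: measurable_innov\<close>)
  have "distr M ?N (\<lambda>\<omega>. \<lambda>i\<in>?I. W \<omega> (innov_shift h i)) =
      distr (distr M ?N (\<lambda>\<omega>. \<lambda>i\<in>?I. W \<omega> i)) ?N (\<lambda>w. \<lambda>i\<in>?I. w (innov_shift h i))"
    by (subst distr_distr) (auto simp: o_def innov_shift_index intro!: distr_cong)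
  also have "\<dots> = distr (Pi\<^sub>M ?I \<nu>) (\<Pi>\<^sub>M i\<in>?I. \<nu> (innov_shift h i)) (\<lambda>w. \<lambda>i\<in>?I. w (innov_shift h i))"
    unfolding Pi by (intro distr_cong refl sets_PiM_cong) (auto simp: \<nu>_def)
  \<comment> \<open>Reindexing a product of probability measures along an injective map yields the
    product of the reindexed factors.\<close>
  also have "\<dots> = (\<Pi>\<^sub>M i\<in>?I. \<nu> (innov_shift h i))"
    using \<nu>(1) inj_innov_shift[of h] innov_shift_index
    by (intro distr_PiM_reindex) (auto intro: inj_on_subset)
  also have "\<dots> = distr M ?N (\<lambda>\<omega>. \<lambda>i\<in>?I. W \<omega> i)"
    unfolding Pi using \<nu>(2) by (intro PiM_cong) auto
  finally have law: "distr M ?N (\<lambda>\<omega>. \<lambda>i\<in>?I. W \<omega> (innov_shift h i)) = distr M ?N (\<lambda>\<omega>. \<lambda>i\<in>?I. W \<omega> i)" .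
  have [measurable]: "?L \<in> ?N \<rightarrow>\<^sub>M ?P"
    by (rule measurable_PiM_single') (auto intro!: measurable_inar_limit[OF innov_past_subset])
  have restrict: "inar_limit n (restrict w ?I) = inar_limit n w" for n w
    using innov_past_subset by (intro inar_limit_cong) auto
  have "distr M ?P (\<lambda>\<omega> n. inar_limit (n + h) (W \<omega>)) = distr M ?P (\<lambda>\<omega>. ?L (\<lambda>i\<in>?I. W \<omega> (innov_shift h i)))"
    by (simp add: restrict inar_limit_shift o_def)
  also have "\<dots> = distr (distr M ?N (\<lambda>\<omega>. \<lambda>i\<in>?I. W \<omega> (innov_shift h i))) ?P ?L"
    by (subst distr_distr) (auto simp: o_def)
  also have "\<dots> = distr M ?P (\<lambda>\<omega>. ?L (\<lambda>i\<in>?I. W \<omega> i))"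
    unfolding law by (subst distr_distr) (auto simp: o_def)
  also have "\<dots> = distr M ?P (\<lambda>\<omega> n. inar_limit n (W \<omega>))"
    by (simp add: restrict)
  finally show "distr M ?P (\<lambda>\<omega> n. inar_limit (n + h) (W \<omega>)) = distr M ?P (\<lambda>\<omega> n. inar_limit n (W \<omega>))" .
qed

text \<open>All values before time \<open>n\<close> factor through the innovations up to
  \<open>n - 1\<close>, so their events lie among those generated by that block.\<close>

lemma inar_causal_inar_limit: "inar_causal M eps xi (\<lambda>n \<omega>. inar_limit n (W \<omega>))"
  unfolding inar_causal_def
proof
  fix n
  let ?S = "Pi\<^sub>M (innov_index_at n) (\<lambda>_. count_space UNIV) :: (_ \<Rightarrow> nat) measure"
  let ?T = "Pi\<^sub>M (innov_past (n - 1)) (\<lambda>_. count_space UNIV) :: (_ \<Rightarrow> nat) measure"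
  let ?P = "Pi\<^sub>M {..<n} (\<lambda>_. count_space UNIV) :: (int \<Rightarrow> nat) measure"
  let ?V = "\<lambda>\<omega>. restrict (W \<omega>) (innov_past (n - 1))"
  let ?L = "\<lambda>w. \<lambda>j\<in>{..<n}. inar_limit j w"
  have L: "?L \<in> ?T \<rightarrow>\<^sub>M ?P"
    by (intro measurable_restrict measurable_inar_limit innov_past_mono) auto
  have "?L (?V \<omega>) = ?L (W \<omega>)" for \<omega>
    by (intro restrict_ext) (simp add: inar_limit_restrict_past)
  then have vimage: "(\<lambda>\<omega>. ?L (W \<omega>)) -` A \<inter> space M = ?V -` (?L -` A \<inter> space ?T) \<inter> space M" for A
    using measurable_space[OF measurable_restrict_innov[OF innov_past_subset, of "n - 1"]]
    by (simp add: set_eq_iff) blast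
  have "{(\<lambda>\<omega>. ?L (W \<omega>)) -` A \<inter> space M | A. A \<in> sets ?P} \<subseteq> {?V -` A \<inter> space M | A. A \<in> sets ?T}"
    unfolding vimage using measurable_sets[OF L] by blast
  also have "\<dots> \<subseteq> sigma_sets (space M) {?V -` A \<inter> space M | A. A \<in> sets ?T}"
    by (rule sigma_sets_superset_generator)
  finally show "indep_set
      {(\<lambda>\<omega>. \<lambda>i\<in>innov_index_at n. innov eps xi i \<omega>) -` A \<inter> space M | A. A \<in> sets ?S}
      {(\<lambda>\<omega>. ?L (W \<omega>)) -` A \<inter> space M | A. A \<in> sets ?P}"
    using indep_innov_at_past[of n] unfolding indep_var_eq
    by (blast intro: indep_set_mono sigma_sets_superset_generator)
qed

text \<open>Monotone convergence carries the uniform bound to the supremum of the exponentials. Its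
  almost sure finiteness forces bounded iterates, and then the limit is itself one of the
  iterates.\<close>

lemma
  assumes s: "s > 0"
    and le: "\<And>j. (\<integral>\<^sup>+ \<omega>. ennreal (exp (s * real (inar_approx j n (W \<omega>)))) \<partial>M) \<le> ennreal c"
  shows AE_bdd_above_inar_approx: "AE \<omega> in M. bdd_above (range (\<lambda>j. inar_approx j n (W \<omega>)))"
    and nn_integral_exp_inar_limit_le:
      "(\<integral>\<^sup>+ \<omega>. ennreal (exp (s * real (inar_limit n (W \<omega>)))) \<partial>M) \<le> ennreal c"
proof -
  note [measurable] = measurable_inar_approx_innov measurable_inar_limit_innov
  define e where "e j \<omega> = ennreal (exp (s * real (inar_approx j n (W \<omega>))))" for j \<omega>
  have [measurable]: "e j \<in> borel_measurable M" for j
    unfolding e_def by measurable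
  have "incseq e"
    using s incseq_inar_approx[of n]
    by (auto simp: incseq_def le_fun_def e_def intro!: ennreal_leI)
  then have "(\<integral>\<^sup>+ \<omega>. (SUP j. e j \<omega>) \<partial>M) = (SUP j. integral\<^sup>N M (e j))"
    by (intro nn_integral_monotone_convergence_SUP) auto
  also have "\<dots> \<le> ennreal c"
    using le by (auto intro!: SUP_least simp: e_def[abs_def])
  finally have int_SUP: "(\<integral>\<^sup>+ \<omega>. (SUP j. e j \<omega>) \<partial>M) \<le> ennreal c" .
  then have "AE \<omega> in M. (SUP j. e j \<omega>) \<noteq> \<infinity>"
    by (intro nn_integral_noteq_infinite) (auto simp: top_unique)
  then show bdd: "AE \<omega> in M. bdd_above (range (\<lambda>j. inar_approx j n (W \<omega>)))"
  proof eventually_elim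
    case (elim \<omega>)
    then obtain r where r: "(SUP j. e j \<omega>) = ennreal r" "r \<ge> 0"
      by (cases "SUP j. e j \<omega>") auto
    have "inar_approx j n (W \<omega>) \<le> nat \<lceil>r / s\<rceil>" for j
    proof -
      have "e j \<omega> \<le> ennreal r"
        unfolding r(1)[symmetric] by (rule SUP_upper) simp
      then have "exp (s * real (inar_approx j n (W \<omega>))) \<le> r"
        using r(2) by (simp add: e_def)
      \<comment> \<open>The crude bound \<open>1 + x \<le> exp x\<close> avoids taking
        logarithms.\<close>
      then have "s * real (inar_approx j n (W \<omega>)) \<le> r"
        using exp_ge_add_one_self[of "s * real (inar_approx j n (W \<omega>))"] by linarith
      then have "real (inar_approx j n (W \<omega>)) \<le> r / s"
        using s by (simp add: field_simps)
      then show ?thesis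
        by linarith
    qed
    then show ?case
      by (intro bdd_aboveI) auto
  qed
  then have "AE \<omega> in M. ennreal (exp (s * real (inar_limit n (W \<omega>)))) \<le> (SUP j. e j \<omega>)"
  proof eventually_elim
    case (elim \<omega>)
    from eventually_happens[OF inar_approx_eventually_eq_limit[OF elim]]
    obtain j where "inar_approx j n (W \<omega>) = inar_limit n (W \<omega>)"
      by auto
    then have "ennreal (exp (s * real (inar_limit n (W \<omega>)))) = e j \<omega>"
      by (simp add: e_def)
    also have "\<dots> \<le> (SUP j. e j \<omega>)"
      by (rule SUP_upper) simp
    finally show ?case .
  qed
  then have "(\<integral>\<^sup>+ \<omega>. ennreal (exp (s * real (inar_limit n (W \<omega>)))) \<partial>M) \<le> (\<integral>\<^sup>+ \<omega>. (SUP j. e j \<omega>) \<partial>M)"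
    by (rule nn_integral_mono_AE)
  with int_SUP show "(\<integral>\<^sup>+ \<omega>. ennreal (exp (s * real (inar_limit n (W \<omega>)))) \<partial>M) \<le> ennreal c"
    by simp
qed

lemma stationary_inar_solution_inar_limit:
  assumes "\<And>n. AE \<omega> in M. bdd_above (range (\<lambda>j. inar_approx j n (W \<omega>)))"
  shows "stationary_inar_solution M eps xi (\<lambda>n \<omega>. inar_limit n (W \<omega>))"
proof -
  \<comment> \<open>There are countably many times, so one null set serves all of them.\<close>
  have "AE \<omega> in M. \<forall>n. bdd_above (range (\<lambda>j. inar_approx j n (W \<omega>)))"
    using assms by (simp add: AE_all_countable)
  then have "inar_equation M eps xi (\<lambda>n \<omega>. inar_limit n (W \<omega>))"
    unfolding inar_equation_def
  proof eventually_elim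
    case (elim \<omega>)
    then show ?case
      using inar_limit_equation[of "W \<omega>"] by (simp add: innov_def)
  qed
  then show ?thesis
    by (simp add: stationary_inar_solution_def measurable_inar_limit_innov
        inar_causal_inar_limit strictly_stationary_inar_limit)
qed

end

section \<open>Mixed moments\<close>

text \<open>Raise \<open>y \<le> exp y\<close> at \<open>y = s * x / Suc p\<close> to the power
  \<open>p\<close>. Dividing by \<open>Suc p\<close> instead of \<open>p\<close> covers
  \<open>p = 0\<close>.\<close>

lemma power_le_exp:
  fixes x s :: real
  assumes "0 \<le> x" "0 < s"
  shows "x ^ p \<le> (real (Suc p) / s) ^ p * exp (s * x)"
proof -
  have "x \<le> real (Suc p) / s * exp (s * x / real (Suc p))"
    using exp_ge_add_one_self[of "s * x / real (Suc p)"] assms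
    by (simp add: field_simps)
  then have "x ^ p \<le> (real (Suc p) / s * exp (s * x / real (Suc p))) ^ p"
    using assms by (intro power_mono) auto
  also have "\<dots> = (real (Suc p) / s) ^ p * exp (real p * (s * x / real (Suc p)))"
    by (simp only: power_mult_distrib exp_of_nat_mult)
  also have "\<dots> \<le> (real (Suc p) / s) ^ p * exp (s * x)"
    using assms by (intro mult_left_mono) (auto simp: divide_le_eq algebra_simps)
  finally show ?thesis .
qed

text \<open>Every base is bounded by the largest one, and the sum over \<open>I\<close> absorbs the
  choice of maximiser. For empty \<open>I\<close> it would read \<open>1 \<le> 0\<close>.\<close>

lemma prod_power_le_sum_power:
  fixes x k :: "'i \<Rightarrow> nat"
  assumes "finite I" "I \<noteq> {}"
  shows "(\<Prod>i\<in>I. x i ^ k i) \<le> (\<Sum>i\<in>I. Suc (x i) ^ sum k I)"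
proof -
  have "Max (x ` I) \<in> x ` I"
    using assms by (intro Max_in) auto
  then obtain i where i: "i \<in> I" "x i = Max (x ` I)"
    by auto
  then have max: "x j \<le> x i" if "j \<in> I" for j
    using assms(1) that by simp
  have "(\<Prod>j\<in>I. x j ^ k j) \<le> (\<Prod>j\<in>I. Suc (x i) ^ k j)"
    using max by (intro prod_mono conjI power_mono) (auto intro: le_SucI)
  also have "\<dots> = Suc (x i) ^ sum k I"
    by (simp add: power_sum)
  also have "\<dots> \<le> (\<Sum>i\<in>I. Suc (x i) ^ sum k I)"
    using assms(1) i(1) by (intro member_le_sum) auto
  finally show ?thesis .
qed

lemma (in prob_space) nn_integral_prod_power_finite:
  fixes X :: "'i \<Rightarrow> 'a \<Rightarrow> nat"
  assumes I: "finite I" "I \<noteq> {}" and s: "s > 0"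
    and [measurable]: "\<And>i. i \<in> I \<Longrightarrow> X i \<in> M \<rightarrow>\<^sub>M count_space UNIV"
    and fin: "\<And>i. i \<in> I \<Longrightarrow> (\<integral>\<^sup>+ \<omega>. ennreal (exp (s * real (X i \<omega>))) \<partial>M) < \<infinity>"
  shows "(\<integral>\<^sup>+ \<omega>. of_nat (\<Prod>i\<in>I. X i \<omega> ^ k i) \<partial>M) < (\<infinity> :: ennreal)"
proof -
  \<comment> \<open>The constant of \<open>power_le_exp\<close> at the total exponent; the factor
    \<open>exp s\<close> pays for passing from \<open>x\<close> to \<open>Suc x\<close>.\<close>
  define c where "c = (real (Suc (sum k I)) / s) ^ sum k I * exp s"
  have c: "c \<ge> 0"
    unfolding c_def using s by (intro mult_nonneg_nonneg zero_le_power divide_nonneg_pos of_nat_0_le_iff) auto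
  have "of_nat (Suc x ^ sum k I) \<le> ennreal c * ennreal (exp (s * real x))" for x
  proof -
    have "real (Suc x) ^ sum k I \<le> c * exp (s * real x)"
      using power_le_exp[of "real (Suc x)" s "sum k I"] s
      by (simp add: c_def distrib_left exp_add mult_ac)
    then have "ennreal (real (Suc x ^ sum k I)) \<le> ennreal (c * exp (s * real x))"
      by (intro ennreal_leI) simp
    then show ?thesis
      using c by (simp only: ennreal_of_nat_eq_real_of_nat ennreal_mult')
  qed
  then have "of_nat (\<Prod>i\<in>I. X i \<omega> ^ k i) \<le> (\<Sum>i\<in>I. ennreal c * ennreal (exp (s * real (X i \<omega>))))" for \<omega>
    by (intro order_trans[OF of_nat_mono[OF prod_power_le_sum_power[OF I]]])
      (simp add: sum_mono del: of_nat_power of_nat_Suc power_Suc)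
  then have "(\<integral>\<^sup>+ \<omega>. of_nat (\<Prod>i\<in>I. X i \<omega> ^ k i) \<partial>M)
      \<le> (\<integral>\<^sup>+ \<omega>. (\<Sum>i\<in>I. ennreal c * ennreal (exp (s * real (X i \<omega>)))) \<partial>M)"
    by (intro nn_integral_mono)
  also have "\<dots> = (\<Sum>i\<in>I. ennreal c * (\<integral>\<^sup>+ \<omega>. ennreal (exp (s * real (X i \<omega>))) \<partial>M))"
    by (subst nn_integral_sum) (auto simp: nn_integral_cmult)
  also have "\<dots> < \<infinity>"
    using fin I(1) by (simp add: ennreal_mult_less_top)
  finally show ?thesis .
qed

theorem corollary1:
  fixes M :: "'a measure" and \<alpha> :: "nat \<Rightarrow> real"
    and eps :: "int \<Rightarrow> 'a \<Rightarrow> nat" and xi :: "int \<Rightarrow> nat \<Rightarrow> nat \<Rightarrow> 'a \<Rightarrow> nat"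
    and X :: "int \<Rightarrow> 'a \<Rightarrow> nat"
    and m :: nat and k :: "nat \<Rightarrow> nat"
  assumes "prob_space M"
    and "\<And>j. \<alpha> j \<ge> 0"
    and "summable (\<lambda>j. \<alpha> (Suc j))" and "(\<Sum>j. \<alpha> (Suc j)) < 1"
    and "inar_sequence M \<alpha> eps xi X"
    and "m \<ge> 1"
  shows "(\<integral>\<^sup>+ \<omega>. of_nat (\<Prod>i = 1..m. X (int i) \<omega> ^ k i) \<partial>M) < (\<infinity> :: ennreal)"
proof -
  interpret prob_space M by fact
  interpret inar_innovation_space M \<alpha> eps xi
    using assms by unfold_locales (auto simp: inar_sequence_def)
  define a where "a = (\<Sum>j. \<alpha> (Suc j))"
  define s where "s = (1 - a) / 2"
  have s: "s > 0"
    using assms(4) by (simp add: s_def a_def)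
  have "(\<Sum>k<j. \<alpha> (Suc k)) \<le> a" for j
    unfolding a_def using assms(2,3) by (intro sum_le_suminf) auto
  then have "(\<integral>\<^sup>+ \<omega>. ennreal (exp (s * real (inar_approx j n (W \<omega>)))) \<partial>M)
      \<le> ennreal (exp (4 * \<alpha> 0 / (1 - a) * s))" for j n
    using s assms(4) by (intro nn_integral_exp_inar_approx_le) (auto simp: s_def a_def)
  note bound = AE_bdd_above_inar_approx[OF s this] nn_integral_exp_inar_limit_le[OF s this]
  \<comment> \<open>The uniqueness clause of \<open>inar_sequence\<close>, applied to the
    constructed solution, transfers its moment bounds to \<open>X\<close>.\<close>
  have "AE \<omega> in M. \<forall>n. inar_limit n (W \<omega>) = X n \<omega>"
    using assms(5) stationary_inar_solution_inar_limit[OF bound(1)] by (simp add: inar_sequence_def)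
  then have "(\<integral>\<^sup>+ \<omega>. of_nat (\<Prod>i = 1..m. X (int i) \<omega> ^ k i) \<partial>M) =
      (\<integral>\<^sup>+ \<omega>. (of_nat (\<Prod>i = 1..m. inar_limit (int i) (W \<omega>) ^ k i) :: ennreal) \<partial>M)"
    by (intro nn_integral_cong_AE) (auto elim!: eventually_mono)
  also have "\<dots> < \<infinity>"
    using assms(6) bound(2) le_less_trans[OF bound(2)]
    by (intro nn_integral_prod_power_finite[OF _ _ s] measurable_inar_limit_innov) auto
  finally show ?thesis .
qed

end
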